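(* Let $G$ be a finite simple graph of order $n$ and size $m$, and let $\widehat{G}$ be the graph obtained from $G$ by attaching a loop at every vertex. Then $$P_{L(\widehat{G})}(\lambda)=(\lambda-1)^{n-m}\lambda^m P_{L(G)}\left(\frac{\lambda^2-\lambda-2}{\lambda}\right).$$
   Context: The order $n$ of $G$ is its number of vertices and the size $m$ is its number of edges. $P_H(x)=\det(xI-A(H))$ is the characteristic polynomial of the adjacency matrix $A(H)$ of a graph $H$ (possibly with loops, a loop contributing $1$ on the diagonal). The identity is read as an identity of rational functions in $\lambda$. $L(G)$ is the line graph of $G$: its vertices are the edges of $G$, two being adjacent whenever they have exactly one vertex in common. The line graph $L(\widehat{G})$ has as vertices the $m$ edges of $G$ and the $n$ loops of $\widehat{G}$; two distinct edges of $G$ are adjacent whenever they share exactly one vertex; the loop at $v$ is a vertex of $L(\widehat{G})$ which itself carries a loop and is adjacent to exactly the edges of $G$ incident with $v$ (distinct loops are not adjacent). Thus $$A(L(\widehat{G}))=\begin{pmatrix} I_n & B(G)\\ B(G)^T & A(L(G))\end{pmatrix},$$ where $B(G)$ is the $n\times m$ vertex-edge incidence ($0/1$) matrix of $G$. *)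

theory Defs
  imports
    "Jordan_Normal_Form.Char_Poly"
    "HOL-Computational_Algebra.Polynomial_Factorial"
    "HOL-Combinatorics.List_Permutation"
begin

section \<open>Graphs with loops\<close>

text \<open>An edge is the set of its end vertices; a singleton edge is a loop.\<close>

datatype 'a ugraph = UGraph (verts: "'a set") (edges: "'a set set")

definition simple_graph :: "'a ugraph \<Rightarrow> bool" where
  "simple_graph G \<longleftrightarrow> finite (verts G) \<and> (\<forall>e\<in>edges G. e \<subseteq> verts G \<and> card e = 2)"

definition add_loops :: "'a ugraph \<Rightarrow> 'a ugraph" where
  "add_loops G = UGraph (verts G) (edges G \<union> {{v} | v. v \<in> verts G})"

text \<open>The case \<open>e = f\<close> is included on purpose. Then \<open>card (e \<inter> f) = 1\<close> says that \<open>e\<close> is a loop,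
  so the vertices of the line graph that carry a loop (\<open>{e, e}\<close> is the singleton \<open>{e}\<close>) are
  exactly the loops of \<open>H\<close>.\<close>

definition line_graph :: "'a ugraph \<Rightarrow> 'a set ugraph" where
  "line_graph H = UGraph (edges H)
     {{e, f} | e f. e \<in> edges H \<and> f \<in> edges H \<and> card (e \<inter> f) = 1}"

section \<open>Characteristic polynomial of a graph\<close>

definition adjacency_matrix :: "'a ugraph \<Rightarrow> 'a list \<Rightarrow> real mat" where
  "adjacency_matrix H xs =
     mat (length xs) (length xs) (\<lambda>(i, j). if {xs ! i, xs ! j} \<in> edges H then 1 else 0)"

text \<open>The enumeration of the vertices is irrelevant, see \<open>graph_char_poly_eq\<close> below.\<close>

definition graph_char_poly :: "'a ugraph \<Rightarrow> real poly" where
  "graph_char_poly H =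
     char_poly (adjacency_matrix H (SOME xs. distinct xs \<and> set xs = verts H))"

section \<open>Rational functions\<close>

text \<open>The field \<open>\<real>(\<lambda>)\<close> is \<^typ>\<open>real poly fract\<close>; \<open>ratfun_X\<close> is the indeterminate, and
  \<open>ratfun_subst p r\<close> is the value \<open>p(r)\<close> of a real polynomial at a rational function.\<close>

definition ratfun_X :: "real poly fract" where
  "ratfun_X = to_fract [:0, 1:]"

definition ratfun_subst :: "real poly \<Rightarrow> real poly fract \<Rightarrow> real poly fract" where
  "ratfun_subst p r = poly (map_poly (\<lambda>c. to_fract [:c:]) p) r"

section \<open>Sanity checks\<close>

lemma ratfun_subst_X: "ratfun_subst p ratfun_X = to_fract p"
proof (induction p)
  case 0
  show ?case by (simp add: ratfun_subst_def)
next
  case (pCons a p)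
  have "to_fract (pCons a p) = to_fract ([:a:] + [:0, 1:] * p)"
    by simp
  also have "\<dots> = to_fract [:a:] + ratfun_X * to_fract p"
    unfolding ratfun_X_def by (simp only: to_fract_add to_fract_mult)
  finally show ?case
    using pCons by (simp add: ratfun_subst_def map_poly_pCons)
qed

lemma char_poly_permute:
  fixes A :: "'a :: comm_ring_1 mat"
  assumes A: "A \<in> carrier_mat n n" and p: "p permutes {0..<n}"
  shows "char_poly (mat n n (\<lambda>(i, j). A $$ (p i, p j))) = char_poly A"
proof -
  let ?C = "char_poly_matrix A"
  have pn: "i < n \<Longrightarrow> p i < n" for i
    using permutes_in_image[OF p, of i] by simp
  have pinj: "p i = p j \<longleftrightarrow> i = j" for i j
    using permutes_inj[OF p] by (auto dest: injD)
  have C: "?C \<in> carrier_mat n n" using A by simp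
  define D where "D = mat n n (\<lambda>(i, j). ?C $$ (p i, j))"
  have D: "D \<in> carrier_mat n n" by (simp add: D_def)
  define E where "E = mat n n (\<lambda>(i, j). D\<^sup>T $$ (p i, j))"
  have E: "E \<in> carrier_mat n n" by (simp add: E_def)
  have "char_poly_matrix (mat n n (\<lambda>(i, j). A $$ (p i, p j))) = E\<^sup>T"
    using A pn pinj by (intro eq_matI) (auto simp: E_def D_def char_poly_matrix_def)
  then have "char_poly (mat n n (\<lambda>(i, j). A $$ (p i, p j))) = det E"
    by (simp add: char_poly_def det_transpose[OF E])
  also have "\<dots> = signof p * det D"
    unfolding E_def using det_permute_rows[OF transpose_carrier_mat[THEN iffD2, OF D] p]
    by (simp add: det_transpose[OF D])
  also have "\<dots> = signof p * (signof p * det ?C)"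
    unfolding D_def using det_permute_rows[OF C p] by simp
  also have "\<dots> = det ?C"
    by (simp add: sign_def)
  finally show ?thesis by (simp add: char_poly_def)
qed

lemma char_poly_adjacency_matrix_cong:
  assumes "distinct xs" "distinct ys" "set xs = set ys"
  shows "char_poly (adjacency_matrix H xs) = char_poly (adjacency_matrix H ys)"
proof -
  have "mset xs = mset ys"
    using assms by (simp add: set_eq_iff_mset_eq_distinct)
  then obtain p where p: "p permutes {..<length ys}" and xs: "permute_list p ys = xs"
    by (rule mset_eq_permutation)
  have len: "length xs = length ys" using xs by auto
  have pn: "i < length ys \<Longrightarrow> p i < length ys" for i
    using permutes_in_image[OF p, of i] by simp
  have "adjacency_matrix H xs =
    mat (length ys) (length ys) (\<lambda>(i, j). adjacency_matrix H ys $$ (p i, p j))"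
    unfolding xs[symmetric] using pn p
    by (intro eq_matI) (auto simp: adjacency_matrix_def permute_list_nth)
  then show ?thesis
    using char_poly_permute[of "adjacency_matrix H ys" "length ys" p] p
    by (simp add: adjacency_matrix_def atLeast0LessThan)
qed

lemma graph_char_poly_eq:
  assumes "distinct xs" "set xs = verts H"
  shows "graph_char_poly H = char_poly (adjacency_matrix H xs)"
proof -
  have "distinct (SOME xs. distinct xs \<and> set xs = verts H) \<and>
        set (SOME xs. distinct xs \<and> set xs = verts H) = verts H"
    by (rule someI[of _ xs]) (use assms in simp)
  then show ?thesis
    unfolding graph_char_poly_def using assms
    by (intro char_poly_adjacency_matrix_cong) auto
qed

lemma line_graph_adjacent_iff:
  "{e, f} \<in> edges (line_graph H) \<longleftrightarrow> e \<in> edges H \<and> f \<in> edges H \<and> card (e \<inter> f) = 1"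
  by (auto simp: line_graph_def doubleton_eq_iff Int_commute)

lemma edges_add_loops_iff: "e \<in> edges (add_loops G) \<longleftrightarrow> e \<in> edges G \<or> (\<exists>v\<in>verts G. e = {v})"
  unfolding add_loops_def by auto

lemma card_singleton_Int: "card ({a} \<inter> f) = 1 \<longleftrightarrow> a \<in> f"
  by (cases "a \<in> f") (simp_all add: Int_insert_left)

lemma loop_adjacent_iff:
  assumes "a \<in> verts G" "f \<in> edges (add_loops G)"
  shows "{{a}, f} \<in> edges (line_graph (add_loops G)) \<longleftrightarrow> a \<in> f"
  using assms unfolding line_graph_adjacent_iff card_singleton_Int edges_add_loops_iff by blast

lemma edge_adjacent_iff:
  assumes "f \<in> edges G" "g \<in> edges G"
  shows "{f, g} \<in> edges (line_graph (add_loops G)) \<longleftrightarrow> {f, g} \<in> edges (line_graph G)"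
  using assms unfolding line_graph_adjacent_iff edges_add_loops_iff by blast

definition incidence_matrix :: "'a list \<Rightarrow> 'a set list \<Rightarrow> real mat" where
  "incidence_matrix vs es =
     mat (length vs) (length es) (\<lambda>(i, j). if vs ! i \<in> es ! j then 1 else 0)"

lemma adjacency_matrix_line_graph_add_loops:
  assumes vs: "distinct vs" "set vs = verts G"
    and es: "distinct es" "set es = edges G"
  shows "adjacency_matrix (line_graph (add_loops G)) (map (\<lambda>v. {v}) vs @ es) =
    four_block_mat (1\<^sub>m (length vs)) (incidence_matrix vs es)
      (incidence_matrix vs es)\<^sup>T (adjacency_matrix (line_graph G) es)"
proof -
  define H where "H = line_graph (add_loops G)"
  have e: "j < length es \<Longrightarrow> es ! j \<in> edges G" for j
    unfolding es(2)[symmetric] by (rule nth_mem)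
  have v: "i < length vs \<Longrightarrow> vs ! i \<in> verts G" for i
    unfolding vs(2)[symmetric] by (rule nth_mem)
  have LL: "({{a}, {b}} \<in> edges H) = (a = b)" if "a \<in> verts G" "b \<in> verts G" for a b
    unfolding H_def using loop_adjacent_iff[of a G "{b}"] that edges_add_loops_iff[of "{b}" G]
    by blast
  have LE: "({{a}, f} \<in> edges H) = (a \<in> f)" if "a \<in> verts G" "f \<in> edges G" for a f
    unfolding H_def using loop_adjacent_iff[of a G f] that edges_add_loops_iff[of f G] by blast
  have EL: "({f, {a}} \<in> edges H) = (a \<in> f)" if "a \<in> verts G" "f \<in> edges G" for a f
    using LE[OF that] by (simp only: insert_commute)
  have EE: "({f, g} \<in> edges H) = ({f, g} \<in> edges (line_graph G))"
    if "f \<in> edges G" "g \<in> edges G" for f g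
    unfolding H_def by (rule edge_adjacent_iff[OF that])
  let ?A = "adjacency_matrix H (map (\<lambda>v. {v}) vs @ es)"
  have A: "?A $$ (i, j) = (if {(map (\<lambda>v. {v}) vs @ es) ! i, (map (\<lambda>v. {v}) vs @ es) ! j} \<in> edges H
      then 1 else 0)" if "i < length vs + length es" "j < length vs + length es" for i j
    using that by (simp add: adjacency_matrix_def)
  have "?A $$ (i, j) =
      four_block_mat (1\<^sub>m (length vs)) (incidence_matrix vs es)
        (incidence_matrix vs es)\<^sup>T (adjacency_matrix (line_graph G) es) $$ (i, j)"
    if ij: "i < length vs + length es" "j < length vs + length es" for i j
  proof (cases "i < length vs"; cases "j < length vs")
    assume i: "i < length vs" and j: "j < length vs"
    have "?A $$ (i, j) = (if vs ! i = vs ! j then 1 else 0)"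
      unfolding A[OF ij] using i j LL[OF v[OF i] v[OF j]]
        by (simp only: nth_append length_map nth_map if_True)
    then show ?thesis
      using i j vs(1) ij
      by (simp add: adjacency_matrix_def incidence_matrix_def nth_eq_iff_index_eq)
  next
    assume i: "i < length vs" and j: "\<not> j < length vs"
    have j': "j - length vs < length es" using ij j by simp
    have "?A $$ (i, j) = (if vs ! i \<in> es ! (j - length vs) then 1 else 0)"
      unfolding A[OF ij] using i j LE[OF v[OF i] e[OF j']]
      by (simp only: nth_append length_map nth_map if_True if_False)
    then show ?thesis
      using i j ij by (simp add: adjacency_matrix_def incidence_matrix_def)
  next
    assume i: "\<not> i < length vs" and j: "j < length vs"
    have i': "i - length vs < length es" using ij i by simp
    have "?A $$ (i, j) = (if vs ! j \<in> es ! (i - length vs) then 1 else 0)"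
      unfolding A[OF ij] using i j EL[OF v[OF j] e[OF i']]
      by (simp only: nth_append length_map nth_map if_True if_False)
    then show ?thesis
      using i j ij by (simp add: adjacency_matrix_def incidence_matrix_def)
  next
    assume i: "\<not> i < length vs" and j: "\<not> j < length vs"
    have i': "i - length vs < length es" and j': "j - length vs < length es" using ij i j by simp_all
    have "?A $$ (i, j) =
        (if {es ! (i - length vs), es ! (j - length vs)} \<in> edges (line_graph G) then 1 else 0)"
      unfolding A[OF ij] using i j EE[OF e[OF i'] e[OF j']]
      by (simp only: nth_append length_map if_False)
    then show ?thesis
      using i j ij by (simp add: adjacency_matrix_def incidence_matrix_def)
  qed
  then show ?thesis
    unfolding H_def[symmetric]
    by (intro eq_matI) (simp_all add: adjacency_matrix_def incidence_matrix_def)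
qed

end

theory Submission
  imports Defs
begin

text \<open>Over the field of rational functions, eliminate the lower left block of
  \<open>\<lambda>I - A(L(G^))\<close> by multiplying from the left with
  \<open>((I, 0), (B\<^sup>T, (\<lambda> - 1) I))\<close>. As \<open>B\<^sup>T B = A(L(G)) + 2I\<close>, the new lower right block
  \<open>(\<lambda> - 1) (\<lambda>I - A(L(G))) - B\<^sup>T B\<close> equals \<open>(\<lambda>\<^sup>2 - \<lambda> - 2) I - \<lambda> A(L(G))\<close>, which is \<open>\<lambda>\<close>
  times the characteristic matrix of \<open>A(L(G))\<close> at \<open>(\<lambda>\<^sup>2 - \<lambda> - 2) / \<lambda>\<close>.\<close>

lemma poly_char_poly_eq_det:
  fixes A :: "'a :: field mat"
  assumes "A \<in> carrier_mat n n"
  shows "poly (char_poly A) k = det (k \<cdot>\<^sub>m 1\<^sub>m n - A)"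
proof -
  have "- char_matrix A k = k \<cdot>\<^sub>m 1\<^sub>m n - A"
    using assms by (intro eq_matI) (auto simp: char_matrix_def)
  then show ?thesis
    by (simp add: char_poly_matrix[OF assms])
qed

text \<open>Stated for values in an arbitrary field, so that it applies with \<open>x\<close> the
  indeterminate of the rational function field. The two conditions on \<open>x\<close> make
  \<open>y\<close> a genuine quotient and the determinant of the multiplier \<open>E\<close>
  invertible.\<close>

lemma poly_char_poly_four_block_one:
  fixes A B C :: "'a :: field mat"
  assumes A: "A \<in> carrier_mat m m" and B: "B \<in> carrier_mat n m" and C: "C \<in> carrier_mat m n"
    and CB: "C * B = A + s \<cdot>\<^sub>m 1\<^sub>m m"
    and x: "x \<noteq> 0" "x \<noteq> 1"
  shows "poly (char_poly (four_block_mat (1\<^sub>m n) B C A)) x =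
    (x - 1) powi (int n - int m) * x ^ m * poly (char_poly A) ((x\<^sup>2 - x - s) / x)"
proof -
  define y where "y = (x\<^sup>2 - x - s) / x"
  define E where "E = four_block_mat (1\<^sub>m n) (0\<^sub>m n m) C ((x - 1) \<cdot>\<^sub>m 1\<^sub>m m)"
  define M where "M = four_block_mat ((x - 1) \<cdot>\<^sub>m 1\<^sub>m n) (- B) (- C) (x \<cdot>\<^sub>m 1\<^sub>m m - A)"
  have xy: "x * y = x * x - x - s"
    using x by (simp add: y_def power2_eq_square)
  have E: "E \<in> carrier_mat (n + m) (n + m)" and M: "M \<in> carrier_mat (n + m) (n + m)"
    unfolding E_def M_def using A by (intro four_block_carrier_mat minus_carrier_mat; simp)+
  have "x \<cdot>\<^sub>m 1\<^sub>m (n + m) - four_block_mat (1\<^sub>m n) B C A = M"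
    unfolding M_def using A B C
    by (intro eq_matI) (auto simp: algebra_simps)
  then have PM: "poly (char_poly (four_block_mat (1\<^sub>m n) B C A)) x = det M"
    using A by (subst poly_char_poly_eq_det[where n = "n + m"]) auto
  have detE: "det E = (x - 1) ^ m"
    unfolding E_def using C by (subst det_four_block_mat_upper_right_zero[where n = n and m = m]) auto
  have ul: "1\<^sub>m n * ((x - 1) \<cdot>\<^sub>m 1\<^sub>m n) + 0\<^sub>m n m * (- C) = (x - 1) \<cdot>\<^sub>m 1\<^sub>m n"
    using C by (intro eq_matI) auto
  have ur: "1\<^sub>m n * (- B) + 0\<^sub>m n m * (x \<cdot>\<^sub>m 1\<^sub>m m - A) = - B"
    using A B by simp
  \<comment> \<open>The scalar \<open>x - 1\<close> in the lower right block of \<open>E\<close> is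
    chosen for this cancellation.\<close>
  have ll: "C * ((x - 1) \<cdot>\<^sub>m 1\<^sub>m n) + ((x - 1) \<cdot>\<^sub>m 1\<^sub>m m) * (- C) = 0\<^sub>m m n"
    using C by (intro eq_matI) (auto simp: mult_smult_distrib[of C m n])
  have "C * (- B) + ((x - 1) \<cdot>\<^sub>m 1\<^sub>m m) * (x \<cdot>\<^sub>m 1\<^sub>m m - A) =
      - (C * B) + (x - 1) \<cdot>\<^sub>m (x \<cdot>\<^sub>m 1\<^sub>m m - A)"
    using A B C mult_smult_assoc_mat[OF one_carrier_mat minus_carrier_mat[OF A], of "x - 1"]
    by (simp add: left_mult_one_mat[OF minus_carrier_mat[OF A]])
  \<comment> \<open>Collecting terms, the coefficient of \<open>A\<close> is -1 - (x - 1) = -x and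
    that of the identity is x(x - 1) - s, which is x y by \<open>xy\<close>.\<close>
  also have "\<dots> = x \<cdot>\<^sub>m (y \<cdot>\<^sub>m 1\<^sub>m m - A)"
    unfolding CB using A by (intro eq_matI) (auto simp: xy algebra_simps)
  finally have lr: "C * (- B) + ((x - 1) \<cdot>\<^sub>m 1\<^sub>m m) * (x \<cdot>\<^sub>m 1\<^sub>m m - A) =
      x \<cdot>\<^sub>m (y \<cdot>\<^sub>m 1\<^sub>m m - A)" .
  have "E * M = four_block_mat ((x - 1) \<cdot>\<^sub>m 1\<^sub>m n) (- B) (0\<^sub>m m n) (x \<cdot>\<^sub>m (y \<cdot>\<^sub>m 1\<^sub>m m - A))"
    unfolding E_def M_def
    by (subst mult_four_block_mat[where ?nr1.0 = n and ?n1.0 = n and ?n2.0 = m and ?nr2.0 = m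
          and ?nc1.0 = n and ?nc2.0 = m], unfold ul ur ll lr)
      (use A B C minus_carrier_mat[OF A] in auto)
  then have "det (E * M) = (x - 1) ^ n * (x ^ m * det (y \<cdot>\<^sub>m 1\<^sub>m m - A))"
    by (simp only:, subst det_four_block_mat_lower_left_zero[where n = n and m = m])
      (use A B minus_carrier_mat[OF A] in auto)
  then have "(x - 1) ^ m * det M = (x - 1) ^ n * (x ^ m * poly (char_poly A) y)"
    by (simp add: det_mult[OF E M] detE poly_char_poly_eq_det[OF A])
  \<comment> \<open>Here \<open>x \<noteq> 1\<close> allows division by \<open>det E\<close>; the
    exponent n - m of the result may be negative.\<close>
  then have "det M = (x - 1) ^ n * (x ^ m * poly (char_poly A) y) / (x - 1) ^ m"
    using x by (metis nonzero_mult_div_cancel_left power_not_zero right_minus_eq)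
  then show ?thesis
    using x by (simp add: PM y_def power_int_diff)
qed

lemma adjacency_matrix_carrier: "adjacency_matrix H xs \<in> carrier_mat (length xs) (length xs)"
  by (simp add: adjacency_matrix_def)

lemma incidence_matrix_carrier: "incidence_matrix vs es \<in> carrier_mat (length vs) (length es)"
  by (simp add: incidence_matrix_def)

text \<open>Two common elements would already exhaust both sets and make them equal. For edges this
  rules out parallel ones.\<close>

lemma card_Int_two_sets:
  assumes "card e = 2" "card f = 2" "e \<noteq> f"
  shows "card (e \<inter> f) \<le> 1"
proof (rule ccontr)
  assume "\<not> card (e \<inter> f) \<le> 1"
  then have "card e \<le> card (e \<inter> f)" "card f \<le> card (e \<inter> f)"
    using assms by simp_all
  moreover have "finite e" "finite f"
    using assms by (auto intro: card_ge_0_finite)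
  ultimately have "e \<inter> f = e" "e \<inter> f = f"
    by (intro card_seteq; simp)+
  then show False
    using assms by blast
qed

text \<open>Entry (i, j) of the product counts the common vertices of the i-th and j-th edge: 2 on
  the diagonal, and otherwise 0 or 1 according to adjacency in the line graph.\<close>

lemma incidence_matrix_transpose_mult:
  assumes G: "simple_graph G"
    and vs: "distinct vs" "set vs = verts G"
    and es: "distinct es" "set es = edges G"
  shows "(incidence_matrix vs es)\<^sup>T * incidence_matrix vs es =
    adjacency_matrix (line_graph G) es + 2 \<cdot>\<^sub>m 1\<^sub>m (length es)"
proof (rule eq_matI)
  fix i j
  assume "i < dim_row (adjacency_matrix (line_graph G) es + 2 \<cdot>\<^sub>m 1\<^sub>m (length es))"
    and "j < dim_col (adjacency_matrix (line_graph G) es + 2 \<cdot>\<^sub>m 1\<^sub>m (length es))"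
  then have ij: "i < length es" "j < length es" by simp_all
  have mem: "es ! i \<in> edges G" "es ! j \<in> edges G"
    using ij es(2) nth_mem by blast+
  then have two: "card (es ! i) = 2" "card (es ! j) = 2" and sub: "es ! i \<subseteq> set vs"
    using G vs(2) by (auto simp: simple_graph_def)
  have "((incidence_matrix vs es)\<^sup>T * incidence_matrix vs es) $$ (i, j) =
      (\<Sum>k<length vs. if vs ! k \<in> es ! i \<inter> es ! j then 1 else 0)"
    using ij by (auto simp: incidence_matrix_def scalar_prod_def atLeast0LessThan intro!: sum.cong)
  also have "\<dots> = (\<Sum>v\<in>set vs. if v \<in> es ! i \<inter> es ! j then 1 else 0)"
    by (rule sum.reindex_bij_betw[OF bij_betw_nth]) (use vs in auto)
  \<comment> \<open>Edges consist of vertices, so restricting the intersection to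
    \<open>set vs\<close> loses nothing.\<close>
  also have "\<dots> = real (card (es ! i \<inter> es ! j))"
    using sub by (simp only: sum.inter_filter[symmetric] finite_set)
      (auto intro!: arg_cong[where f = card])
  also have "\<dots> = (adjacency_matrix (line_graph G) es + 2 \<cdot>\<^sub>m 1\<^sub>m (length es)) $$ (i, j)"
  proof (cases "i = j")
    case True
    \<comment> \<open>The pair of an edge with itself collapses to a singleton, hence the simplified
      criterion. It fails because the edge meets itself in two vertices, so the line graph has no
      loop there.\<close>
    then show ?thesis
      using ij two by (simp add: adjacency_matrix_def line_graph_adjacent_iff[of "es ! j" "es ! j", simplified])
  next
    case False
    then have "es ! i \<noteq> es ! j"
      using es(1) ij by (simp add: nth_eq_iff_index_eq)
    then have "card (es ! i \<inter> es ! j) \<le> 1"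
      using two by (intro card_Int_two_sets)
    then have "card (es ! i \<inter> es ! j) = 0 \<or> card (es ! i \<inter> es ! j) = 1"
      by linarith
    then show ?thesis
      using False ij mem by (auto simp: adjacency_matrix_def line_graph_adjacent_iff)
  qed
  finally show "((incidence_matrix vs es)\<^sup>T * incidence_matrix vs es) $$ (i, j) =
      (adjacency_matrix (line_graph G) es + 2 \<cdot>\<^sub>m 1\<^sub>m (length es)) $$ (i, j)" .
qed (simp_all add: adjacency_matrix_def incidence_matrix_def)

text \<open>Embedding the reals as constant rational functions carries matrix products and
  characteristic polynomials along entrywise.\<close>

interpretation const_fract: comm_ring_hom "\<lambda>c :: real. to_fract [:c:]"
proof
  show "to_fract [:x + y:] = to_fract [:x:] + to_fract [:y:]" for x y :: real
    unfolding to_fract_add[symmetric] by simp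
  show "to_fract [:x * y:] = to_fract [:x:] * to_fract [:y:]" for x y :: real
    unfolding to_fract_mult[symmetric] by simp
qed (simp_all add: pCons_one)

text \<open>Characteristic polynomials commute with ring homomorphisms, so substitution becomes
  evaluation over a field, as the block lemma requires.\<close>

lemma ratfun_subst_char_poly:
  assumes "A \<in> carrier_mat n n"
  shows "ratfun_subst (char_poly A) r = poly (char_poly (map_mat (\<lambda>c. to_fract [:c:]) A)) r"
  by (simp add: ratfun_subst_def const_fract.char_poly_hom[OF assms])

lemma ratfun_X_neq: "ratfun_X \<noteq> 0" "ratfun_X \<noteq> 1"
proof -
  show "ratfun_X \<noteq> 0"
    by (simp add: ratfun_X_def)
  have "to_fract [:0, 1 :: real:] \<noteq> to_fract 1"
    unfolding to_fract_eq_iff by (simp add: one_pCons)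
  then show "ratfun_X \<noteq> 1"
    by (simp add: ratfun_X_def)
qed

theorem theorem2p8:
  fixes G :: "'a ugraph" and n m :: nat
  assumes "simple_graph G"
    and "n = card (verts G)"
    and "m = card (edges G)"
  shows "to_fract (graph_char_poly (line_graph (add_loops G))) =
    (ratfun_X - 1) powi (int n - int m) * ratfun_X ^ m *
      ratfun_subst (graph_char_poly (line_graph G)) ((ratfun_X ^ 2 - ratfun_X - 2) / ratfun_X)"
proof -
  let ?h = "\<lambda>c :: real. to_fract [:c:]"
  have "finite (verts G)"
    using assms(1) by (simp add: simple_graph_def)
  moreover from this have "finite (edges G)"
    using assms(1) by (auto simp: simple_graph_def intro: finite_subset[of _ "Pow (verts G)"])
  ultimately obtain vs es where vs: "distinct vs" "set vs = verts G"
    and es: "distinct es" "set es = edges G"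
    using finite_distinct_list by metis
  define B where "B = incidence_matrix vs es"
  define A where "A = adjacency_matrix (line_graph G) es"
  have n: "length vs = n" and m: "length es = m"
    using vs es assms(2,3) distinct_card by metis+
  have A: "A \<in> carrier_mat m m" and B: "B \<in> carrier_mat n m"
    using adjacency_matrix_carrier[of "line_graph G" es] incidence_matrix_carrier[of vs es]
    by (simp_all add: A_def B_def n m)
  have BB: "B\<^sup>T * B = A + 2 \<cdot>\<^sub>m 1\<^sub>m m"
    using incidence_matrix_transpose_mult[OF assms(1) vs es] by (simp add: A_def B_def m)
  have "map_mat ?h B\<^sup>T * map_mat ?h B = map_mat ?h (B\<^sup>T * B)"
    using B by (intro const_fract.mat_hom_mult[symmetric]) auto
  also have "\<dots> = map_mat ?h A + 2 \<cdot>\<^sub>m 1\<^sub>m m"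
    \<comment> \<open>The instance at 1 and 1 shows that the embedding maps 2 to 2.\<close>
    unfolding BB using A const_fract.hom_add[of 1 1]
    by (intro eq_matI) (auto simp: const_fract.hom_add)
  finally have hBB: "map_mat ?h B\<^sup>T * map_mat ?h B = map_mat ?h A + 2 \<cdot>\<^sub>m 1\<^sub>m m" .
  let ?L = "four_block_mat (1\<^sub>m n) B B\<^sup>T A"
  have L: "?L \<in> carrier_mat (n + m) (n + m)"
    using A by simp
  have hL: "map_mat ?h ?L =
      four_block_mat (1\<^sub>m n) (map_mat ?h B) (map_mat ?h B\<^sup>T) (map_mat ?h A)"
    using A B by (intro eq_matI) auto
  \<comment> \<open>Any enumeration may be used; loops are listed before edges to obtain the block
    form. It is distinct since loops have one element and edges two.\<close>
  have "graph_char_poly (line_graph (add_loops G)) = char_poly ?L"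
    using adjacency_matrix_line_graph_add_loops[OF vs es] vs es assms(1)
    by (subst graph_char_poly_eq[of "map (\<lambda>v. {v}) vs @ es"])
      (auto simp: A_def B_def n m distinct_map line_graph_def add_loops_def simple_graph_def)
  moreover have LG: "graph_char_poly (line_graph G) = char_poly A"
    unfolding A_def using es by (intro graph_char_poly_eq) (simp_all add: line_graph_def)
  \<comment> \<open>Read backwards, \<open>ratfun_subst_X\<close> turns the left side into a value
    at the indeterminate.\<close>
  ultimately have "to_fract (graph_char_poly (line_graph (add_loops G))) =
      poly (char_poly (map_mat ?h ?L)) ratfun_X"
    by (simp add: ratfun_subst_char_poly[OF L] flip: ratfun_subst_X)
  also have "\<dots> = (ratfun_X - 1) powi (int n - int m) * ratfun_X ^ m *
      poly (char_poly (map_mat ?h A)) ((ratfun_X\<^sup>2 - ratfun_X - 2) / ratfun_X)"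
    unfolding hL
    by (rule poly_char_poly_four_block_one[OF _ _ _ hBB]) (use A B ratfun_X_neq in auto)
  also have "poly (char_poly (map_mat ?h A)) ((ratfun_X\<^sup>2 - ratfun_X - 2) / ratfun_X) =
      ratfun_subst (graph_char_poly (line_graph G)) ((ratfun_X ^ 2 - ratfun_X - 2) / ratfun_X)"
    unfolding LG ratfun_subst_char_poly[OF A] ..
  finally show ?thesis .
qed

end
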